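(* Assume $\dim S_1=3$, let $f\in S_d$ with $d\ge 3$, and suppose that $\Sigma\subset\mathbb{P}S^1$ is a finite set such that $\partial_{l'l''}f\ne 0$ for all $\langle l'\rangle,\langle l''\rangle\in\Sigma$ (including the case $\langle l'\rangle=\langle l''\rangle$). Then there exist distinct $\langle l^1\rangle,\ldots,\langle l^{d-1}\rangle\in\mathbb{P}S^1\setminus\Sigma$ such that $\partial_{l^1\cdots l^{d-1}}f=0$.
   Context: $\mathbb{K}$ is an algebraically closed field of characteristic $0$. $S_\bullet=\operatorname{Sym}^\bullet S_1$ is the graded ring of polynomials over $\mathbb{K}$ on the finite-dimensional vector space $S_1$ of linear forms, and $S^\bullet=\operatorname{Sym}^\bullet S^1$ is the graded polynomial ring on the dual space $S^1$ of $S_1$. For $p\in S^\bullet$, $\partial_p:S_\bullet\to S_\bullet$ is the contraction operator: in dual bases $x_0,\ldots,x_n$ of $S_1$ and $x^0,\ldots,x^n$ of $S^1$, $\partial_{x^i}$ is the partial derivative with respect to $x_i$, $p\mapsto\partial_p$ is linear and $\partial_{pq}=\partial_p\circ\partial_q$. For a vector space $V$, $\mathbb{P}V$ is the set of one-dimensional subspaces $\langle v\rangle$, $v\neq0$. Superscripts on $l^1,l^2,\ldots$ are indices, not powers. *)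

theory Defs
  imports
    "HOL-Computational_Algebra.Polynomial"
    "HOL-Library.Poly_Mapping"
begin

text \<open>
  Let \<open>S\<^sub>1\<close> have basis \<open>(x\<^sub>i)\<close> and let \<open>S\<^sup>1\<close> have the dual basis \<open>(x\<^sup>i)\<close>, with \<open>i\<close> running through
  the finite type \<open>'x\<close>. In coordinates, \<open>Sym S\<^sub>1\<close> and \<open>Sym S\<^sup>1\<close> are both the polynomial ring over
  \<open>'k\<close> in variables indexed by \<open>'x\<close>, with a polynomial given by its finitely supported family of
  coefficients. The same type therefore serves for both, and \<open>var i\<close> denotes \<open>x\<^sub>i\<close> in the first
  ring and \<open>x\<^sup>i\<close> in the second one.
\<close>

type_synonym ('x, 'k) mpoly = "('x \<Rightarrow>\<^sub>0 nat) \<Rightarrow>\<^sub>0 'k"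

definition var :: "'x \<Rightarrow> ('x, 'k::comm_ring_1) mpoly" where
  "var i = Poly_Mapping.single (Poly_Mapping.single i 1) 1"

definition mscale :: "'k \<Rightarrow> ('x, 'k::comm_ring_1) mpoly \<Rightarrow> ('x, 'k) mpoly" where
  "mscale c p = Poly_Mapping.single 0 c * p"

lemma lookup_mscale [simp]: "Poly_Mapping.lookup (mscale c p) m = c * Poly_Mapping.lookup p m"
proof -
  have "mscale c p = Poly_Mapping.map ((*) c) p"
    by (simp add: mscale_def mult_map_scale_conv_mult)
  thus ?thesis by (simp add: Poly_Mapping.map.rep_eq when_def)
qed

global_interpretation mpoly: vector_space "mscale :: 'k::field \<Rightarrow> ('x, 'k) mpoly \<Rightarrow> ('x, 'k) mpoly"
  by unfold_locales (auto intro!: poly_mapping_eqI simp: lookup_add algebra_simps)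

text \<open>The homogeneous component of degree \<open>d\<close>, zero included.\<close>

definition forms :: "nat \<Rightarrow> ('x::finite, 'k::comm_ring_1) mpoly set" where
  "forms d = {p. \<forall>m\<in>Poly_Mapping.keys p. (\<Sum>i\<in>UNIV. Poly_Mapping.lookup m i) = d}"

text \<open>The set of one-dimensional subspaces of \<open>V\<close>.\<close>

definition proj_space :: "('x, 'k::field) mpoly set \<Rightarrow> ('x, 'k) mpoly set set" where
  "proj_space V = {mpoly.span {v} | v. v \<in> V \<and> v \<noteq> 0}"

definition partial :: "'x \<Rightarrow> ('x, 'k::comm_ring_1) mpoly \<Rightarrow> ('x, 'k) mpoly" where
  "partial i f = (\<Sum>m\<in>Poly_Mapping.keys f.
     Poly_Mapping.single (m - Poly_Mapping.single i 1) (of_nat (Poly_Mapping.lookup m i) * Poly_Mapping.lookup f m))"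

text \<open>
  \<open>partial_monom m\<close> is the composition over all \<open>i\<close> of the \<open>Poly_Mapping.lookup m i\<close>-fold iterates of
  \<open>partial i\<close>; these operators commute, so the order is irrelevant. Extending linearly in \<open>p\<close>
  gives \<open>contraction p\<close>, that is \<open>\<partial>\<^sub>p\<close>. It is determined by the lemmas \<open>contraction_add\<close>,
  \<open>contraction_mscale\<close>, \<open>contraction_one\<close>, \<open>contraction_mult\<close> and \<open>contraction_var\<close> below.
\<close>

definition partial_monom :: "('x::finite \<Rightarrow>\<^sub>0 nat) \<Rightarrow> ('x, 'k::comm_ring_1) mpoly \<Rightarrow> ('x, 'k) mpoly" where
  "partial_monom m f = Finite_Set.fold (\<lambda>i. partial i ^^ Poly_Mapping.lookup m i) f UNIV"

definition contraction :: "('x::finite, 'k::comm_ring_1) mpoly \<Rightarrow> ('x, 'k) mpoly \<Rightarrow> ('x, 'k) mpoly" where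
  "contraction p f = (\<Sum>m\<in>Poly_Mapping.keys p. mscale (Poly_Mapping.lookup p m) (partial_monom m f))"

lemma lookup_partial:
  "Poly_Mapping.lookup (partial i f) m = of_nat (Suc (Poly_Mapping.lookup m i)) * Poly_Mapping.lookup f (m + Poly_Mapping.single i 1)"
proof -
  let ?e = "Poly_Mapping.single i (1::nat)"
  have *: "(of_nat (Poly_Mapping.lookup n i) * Poly_Mapping.lookup f n when n - ?e = m) =
      (if n = m + ?e then of_nat (Suc (Poly_Mapping.lookup m i)) * Poly_Mapping.lookup f (m + ?e) else 0)" for n
  proof (cases "n = m + ?e")
    case True
    thus ?thesis by (simp add: lookup_add)
  next
    case False
    have "Poly_Mapping.lookup n i = 0" if "n - ?e = m"
    proof (rule ccontr)
      assume "Poly_Mapping.lookup n i \<noteq> 0"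
      hence "n = (n - ?e) + ?e"
        by (intro poly_mapping_eqI) (auto simp: lookup_add lookup_minus lookup_single when_def)
      with that False show False by simp
    qed
    with False show ?thesis by (simp add: when_def)
  qed
  have "Poly_Mapping.lookup (partial i f) m =
      (\<Sum>n\<in>Poly_Mapping.keys f. if n = m + ?e then of_nat (Suc (Poly_Mapping.lookup m i)) * Poly_Mapping.lookup f (m + ?e) else 0)"
    unfolding partial_def lookup_sum lookup_single * ..
  thus ?thesis
    by (simp add: in_keys_iff del: of_nat_Suc)
qed

lemma partial_add: "partial i (f + g) = partial i f + partial i g"
  by (rule poly_mapping_eqI) (simp add: lookup_partial lookup_add algebra_simps)

lemma partial_mscale: "partial i (mscale c f) = mscale c (partial i f)"
  by (rule poly_mapping_eqI) (simp add: lookup_partial algebra_simps)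

lemma partial_commute: "partial i (partial j f) = partial j (partial i f)"
  by (cases "i = j"; rule poly_mapping_eqI)
     (simp_all add: lookup_partial lookup_add lookup_single ac_simps)

lemma partial_var: "partial i (var j) = (if i = j then 1 else 0)"
proof (rule poly_mapping_eqI)
  fix m :: "'a \<Rightarrow>\<^sub>0 nat"
  have "Poly_Mapping.single j (1::nat) = m + Poly_Mapping.single i 1 \<longleftrightarrow> i = j \<and> m = 0"
    by (auto simp: poly_mapping_eq_iff fun_eq_iff lookup_add lookup_single when_def split: if_splits)
  thus "Poly_Mapping.lookup (partial i (var j)) m = Poly_Mapping.lookup (if i = j then 1 else 0 :: ('a, 'b) mpoly) m"
    by (auto simp: lookup_partial var_def lookup_single lookup_one when_def)
qed

lemma partial_pow_add: "(partial i ^^ n) (f + g) = (partial i ^^ n) f + (partial i ^^ n) g"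
  by (induction n) (simp_all add: partial_add)

lemma partial_pow_mscale: "(partial i ^^ n) (mscale c f) = mscale c ((partial i ^^ n) f)"
  by (induction n) (simp_all add: partial_mscale)

lemma partial_pow_commute:
  "(partial i ^^ a) ((partial j ^^ b) f) = (partial j ^^ b) ((partial i ^^ a) f)"
proof -
  have *: "partial i ((partial j ^^ b) f) = (partial j ^^ b) (partial i f)" for f :: "('a, 'b) mpoly"
    by (induction b) (simp_all, metis partial_commute)
  show ?thesis by (induction a) (simp_all add: *)
qed

interpretation partial_pow: comp_fun_commute "\<lambda>i. partial i ^^ Poly_Mapping.lookup m i" for m
  by unfold_locales (auto simp: fun_eq_iff partial_pow_commute)

lemma partial_monom_add: "partial_monom m (f + g) = partial_monom m f + partial_monom m g"
proof -
  have "Finite_Set.fold (\<lambda>i. partial i ^^ Poly_Mapping.lookup m i) (f + g) A =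
      Finite_Set.fold (\<lambda>i. partial i ^^ Poly_Mapping.lookup m i) f A +
      Finite_Set.fold (\<lambda>i. partial i ^^ Poly_Mapping.lookup m i) g A" if "finite A" for A
    using that by (induction A) (simp_all add: partial_pow_add)
  thus ?thesis by (simp add: partial_monom_def)
qed

lemma partial_monom_mscale: "partial_monom m (mscale c f) = mscale c (partial_monom m f)"
proof -
  have "Finite_Set.fold (\<lambda>i. partial i ^^ Poly_Mapping.lookup m i) (mscale c f) A =
      mscale c (Finite_Set.fold (\<lambda>i. partial i ^^ Poly_Mapping.lookup m i) f A)" if "finite A" for A
    using that by (induction A) (simp_all add: partial_pow_mscale)
  thus ?thesis by (simp add: partial_monom_def)
qed

lemma partial_monom_plus: "partial_monom (m + n) f = partial_monom m (partial_monom n f)"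
proof -
  let ?F = "\<lambda>m f A. Finite_Set.fold (\<lambda>i. partial i ^^ Poly_Mapping.lookup m i) f A"
  have comm: "?F m ((partial j ^^ b) f) A = (partial j ^^ b) (?F m f A)"
    if "finite A" for A j b and f :: "('a, 'b) mpoly"
    using that by (induction A) (simp_all add: partial_pow_commute)
  have "?F (m + n) f A = ?F m (?F n f A) A" if "finite A" for A
    using that
  proof (induction A)
    case (insert a A)
    show ?case
      by (simp only: partial_pow.fold_insert[OF insert.hyps] insert.IH comm[OF insert.hyps(1)])
         (simp only: lookup_add funpow_add o_apply)
  qed simp
  thus ?thesis by (simp add: partial_monom_def)
qed

lemma partial_monom_zero: "partial_monom 0 f = f"
proof -
  have "Finite_Set.fold (\<lambda>i. partial i ^^ Poly_Mapping.lookup (0 :: 'a \<Rightarrow>\<^sub>0 nat) i) f A = f" if "finite A" for A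
    using that
  proof (induction A)
    case (insert a A)
    show ?case by (simp only: partial_pow.fold_insert[OF insert.hyps] insert.IH) simp
  qed simp
  thus ?thesis by (simp add: partial_monom_def)
qed

lemma partial_monom_single: "partial_monom (Poly_Mapping.single i 1) f = partial i f"
proof -
  let ?F = "\<lambda>A. Finite_Set.fold (\<lambda>j. partial j ^^ Poly_Mapping.lookup (Poly_Mapping.single i (1::nat)) j) f A"
  have "?F A = (if i \<in> A then partial i f else f)" if "finite A" for A
    using that
  proof (induction A)
    case (insert a A)
    show ?case
      by (simp only: partial_pow.fold_insert[OF insert.hyps] insert.IH)
         (use insert.hyps in \<open>auto simp: lookup_single when_def\<close>)
  qed simp
  thus ?thesis by (simp add: partial_monom_def)
qed

lemma mscale_simps:
  "mscale 0 p = 0" "mscale 1 p = p" "mscale c 0 = 0" "mscale c (p + q) = mscale c p + mscale c q"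
  "mscale (a + b) p = mscale a p + mscale b p" "mscale a (mscale b p) = mscale (a * b) p"
  by (auto intro!: poly_mapping_eqI simp: lookup_add algebra_simps)

lemma contraction_superset:
  assumes "finite A" "Poly_Mapping.keys p \<subseteq> A"
  shows "contraction p f = (\<Sum>m\<in>A. mscale (Poly_Mapping.lookup p m) (partial_monom m f))"
  unfolding contraction_def
  by (rule sum.mono_neutral_left) (use assms in \<open>auto simp: in_keys_iff mscale_simps\<close>)

lemma contraction_add: "contraction (p + q) f = contraction p f + contraction q f"
proof -
  let ?A = "Poly_Mapping.keys p \<union> Poly_Mapping.keys q"
  have "Poly_Mapping.keys (p + q) \<subseteq> ?A" by (rule keys_add)
  thus ?thesis
    by (simp add: contraction_superset[of ?A] lookup_add mscale_simps sum.distrib)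
qed

lemma mscale_sum: "mscale c (\<Sum>x\<in>A. g x) = (\<Sum>x\<in>A. mscale c (g x))"
  by (simp add: mscale_def sum_distrib_left)

lemma contraction_mscale: "contraction (mscale c p) f = mscale c (contraction p f)"
proof -
  have "Poly_Mapping.keys (mscale c p) \<subseteq> Poly_Mapping.keys p" by (auto simp: in_keys_iff)
  thus ?thesis
    by (simp add: contraction_superset[of "Poly_Mapping.keys p"] mscale_sum mscale_simps)
qed

lemma contraction_monom:
  "contraction (Poly_Mapping.single m c) f = mscale c (partial_monom m f)"
  by (simp add: contraction_superset[of "{m}"])

lemma contraction_one: "contraction 1 f = f"
  by (simp add: contraction_monom partial_monom_zero mscale_simps flip: single_one)

lemma contraction_var: "contraction (var i) f = partial i f"
  by (simp only: var_def contraction_monom partial_monom_single mscale_simps)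

lemma contraction_zero: "contraction 0 f = 0"
  by (simp add: contraction_def)

lemma contraction_sum: "contraction (\<Sum>x\<in>A. p x) f = (\<Sum>x\<in>A. contraction (p x) f)"
  by (induction A rule: infinite_finite_induct) (simp_all add: contraction_zero contraction_add)

lemma contraction_add_right: "contraction p (f + g) = contraction p f + contraction p g"
  by (simp add: contraction_def partial_monom_add mscale_simps sum.distrib)

lemma contraction_mscale_right: "contraction p (mscale c f) = mscale c (contraction p f)"
  by (simp add: contraction_def partial_monom_mscale mscale_sum mscale_simps mult.commute)

lemma contraction_zero_right: "contraction p 0 = 0"
  using contraction_mscale_right[of p 0 0] by (simp add: mscale_simps)

lemma contraction_sum_right: "contraction p (\<Sum>x\<in>A. f x) = (\<Sum>x\<in>A. contraction p (f x))"
  by (induction A rule: infinite_finite_induct)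
     (simp_all add: contraction_zero_right contraction_add_right)

lemma mpoly_eq_sum_single: "(p :: ('x, 'k::comm_ring_1) mpoly) =
    (\<Sum>m\<in>Poly_Mapping.keys p. Poly_Mapping.single m (Poly_Mapping.lookup p m))"
  by (rule poly_mapping_eqI) (simp add: lookup_sum lookup_single when_def in_keys_iff)

lemma contraction_mult: "contraction (p * q) f = contraction p (contraction q f)"
proof -
  have monom: "contraction (Poly_Mapping.single m a * Poly_Mapping.single n b) f =
      contraction (Poly_Mapping.single m a) (contraction (Poly_Mapping.single n b) f)" for m n a b
    by (simp add: mult_single contraction_monom partial_monom_plus partial_monom_mscale mscale_simps)
  have "contraction (p * q) f =
      contraction ((\<Sum>m\<in>Poly_Mapping.keys p. Poly_Mapping.single m (Poly_Mapping.lookup p m)) *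
        (\<Sum>m\<in>Poly_Mapping.keys q. Poly_Mapping.single m (Poly_Mapping.lookup q m))) f"
    by (simp flip: mpoly_eq_sum_single)
  also have "\<dots> = contraction (\<Sum>m\<in>Poly_Mapping.keys p. Poly_Mapping.single m (Poly_Mapping.lookup p m))
        (contraction (\<Sum>m\<in>Poly_Mapping.keys q. Poly_Mapping.single m (Poly_Mapping.lookup q m)) f)"
    by (simp add: sum_product contraction_sum contraction_sum_right monom
        sum.swap[of _ "Poly_Mapping.keys p"])
  finally show ?thesis by (simp flip: mpoly_eq_sum_single)
qed

lemma forms_1_eq_span: "forms 1 = mpoly.span (range (var :: 'x::finite \<Rightarrow> ('x, 'k::field) mpoly))"
proof (intro equalityI subsetI)
  fix p :: "('x, 'k) mpoly"
  assume p: "p \<in> forms 1"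
  have "Poly_Mapping.single m (Poly_Mapping.lookup p m) \<in> mpoly.span (range (var :: 'x \<Rightarrow> ('x, 'k) mpoly))"
    if "m \<in> Poly_Mapping.keys p" for m
  proof -
    have "(\<Sum>i\<in>UNIV. Poly_Mapping.lookup m i) = 1" using p that by (auto simp: forms_def)
    then obtain i where i: "Poly_Mapping.lookup m i = 1" "\<forall>j. j \<noteq> i \<longrightarrow> Poly_Mapping.lookup m j = 0"
      by (subst (asm) sum_eq_1_iff) auto
    hence "m = Poly_Mapping.single i 1"
      by (intro poly_mapping_eqI) (auto simp: lookup_single when_def)
    hence "Poly_Mapping.single m (Poly_Mapping.lookup p m) = mscale (Poly_Mapping.lookup p m) (var i)"
      by (simp add: mscale_def var_def mult_single)
    thus ?thesis by (simp add: mpoly.span_scale mpoly.span_base)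
  qed
  thus "p \<in> mpoly.span (range var)"
    by (subst mpoly_eq_sum_single) (auto intro!: mpoly.span_sum)
next
  fix p :: "('x, 'k) mpoly"
  assume "p \<in> mpoly.span (range var)"
  moreover have "mpoly.subspace (forms 1 :: ('x, 'k) mpoly set)"
    unfolding mpoly.subspace_def forms_def
    by (auto simp: in_keys_iff lookup_add)
  moreover have "range var \<subseteq> (forms 1 :: ('x, 'k) mpoly set)"
    by (auto simp: forms_def var_def lookup_single when_def)
  ultimately show "p \<in> forms 1" using mpoly.span_minimal by blast
qed

lemma inj_var: "inj (var :: 'x \<Rightarrow> ('x, 'k::field) mpoly)"
proof (rule injI)
  fix i j :: 'x
  assume "var i = (var j :: ('x, 'k) mpoly)"
  hence "partial i (var i) = partial i (var j :: ('x, 'k) mpoly)" by simp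
  thus "i = j" by (simp add: partial_var split: if_splits)
qed

lemma independent_var:
  "mpoly.independent (range (var :: 'x::finite \<Rightarrow> ('x, 'k::field) mpoly))"
proof (rule mpoly.independent_if_scalars_zero)
  show "finite (range (var :: 'x \<Rightarrow> ('x, 'k) mpoly))" by simp
next
  fix u :: "('x, 'k) mpoly \<Rightarrow> 'k" and x :: "('x, 'k) mpoly"
  assume sum0: "(\<Sum>v\<in>range var. mscale (u v) v) = 0" and "x \<in> range var"
  then obtain i where x: "x = var i" by auto
  have "0 = Poly_Mapping.lookup (\<Sum>j\<in>UNIV. mscale (u (var j)) (var j)) (Poly_Mapping.single i 1)"
    using sum0 by (simp add: sum.reindex[OF inj_var] o_def)
  also have "\<dots> = (\<Sum>j\<in>UNIV. if j = i then u (var j) else 0)"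
    unfolding lookup_sum
    by (intro sum.cong)
       (auto simp: var_def lookup_single when_def poly_mapping_eq_iff fun_eq_iff split: if_splits)
  finally show "u x = 0" using x by simp
qed

lemma dim_forms_1:
  "mpoly.dim (forms 1 :: ('x::finite, 'k::field) mpoly set) = card (UNIV :: 'x set)"
  by (simp only: forms_1_eq_span mpoly.dim_span_eq_card_independent[OF independent_var]
      card_image[OF inj_var])

end

theory Submission
  imports Defs "HOL-Analysis.Determinants"
begin

text \<open>
  Induction on \<open>d\<close>. For \<open>d > 3\<close>, a generic \<open>l\<close> makes \<open>\<partial>\<^sub>l f\<close> satisfy the hypothesis for
  \<open>\<Sigma> \<union> {\<langle>l\<rangle>}\<close>, since this amounts to finitely many nonvanishing conditions on
  \<open>\<partial>\<^sub>l (\<partial>\<^sub>s \<partial>\<^sub>t f)\<close>, \<open>\<partial>\<^sub>l\<^sup>2 (\<partial>\<^sub>s f)\<close> and \<open>\<partial>\<^sub>l\<^sup>3 f\<close>.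

  For \<open>d = 3\<close> one needs \<open>\<langle>l\<rangle> \<noteq> \<langle>l'\<rangle>\<close> outside \<open>\<Sigma>\<close> with \<open>\<partial>\<^sub>l \<partial>\<^sub>l\<^sub>' f = 0\<close>. A line that avoids
  a given finite set of points contains a point \<open>l\<close> whose polar conic \<open>\<partial>\<^sub>l f\<close> is singular at some \<open>l'\<close>,
  so there are infinitely many such \<open>l\<close>. If no pair \<open>(l, l')\<close> is as desired, then always
  \<open>l' = l\<close> or \<open>l' \<in> \<Sigma>\<close>. If some \<open>s \<in> \<Sigma>\<close> occurs for two different \<open>l\<close>, then \<open>\<partial>\<^sub>s f\<close> is the square of a
  linear form, \<open>f\<close> is a cube plus a binary cubic, and a pair can be found from the binary cubic. Otherwise
  \<open>l' = l\<close> for infinitely many \<open>l\<close>, that is, the cubic \<open>f\<close> has infinitely many singular points;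
  but among any four singular points there are two with \<open>\<partial>\<^sub>l \<partial>\<^sub>l\<^sub>' f = 0\<close>.
\<close>

section \<open>Singular members of pencils of square matrices\<close>

lemma singular_matrix_kernel:
  fixes M :: "'k::field ^ 'n ^ 'n"
  assumes "det M = 0"
  shows "\<exists>v. v \<noteq> 0 \<and> M *v v = 0"
  using assms invertible_det_nz[of M] invertible_left_inverse[of M] matrix_left_invertible_ker[of M]
  by auto

lemma poly_det_pencil:
  fixes A B :: "'n::finite \<Rightarrow> 'n \<Rightarrow> 'k::comm_ring_1"
  shows "poly (det (\<chi> i j. [:A i j, B i j:])) t = det (\<chi> i j. A i j + t * B i j)"
  by (simp add: det_def poly_sum poly_prod)

text \<open>The determinant of \<open>x A + y B\<close> is a binary form in \<open>x\<close> and
  \<open>y\<close>, so it has a nontrivial zero over an algebraically closed field. The parameters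
  are homogeneous because \<open>B\<close> may be the only singular member.\<close>

lemma singular_member_of_pencil:
  fixes A B :: "'n::finite \<Rightarrow> 'n \<Rightarrow> 'k::{alg_closed_field, field_char_0}"
  shows "\<exists>x y v. (x \<noteq> 0 \<or> y \<noteq> 0) \<and> (\<exists>j. v j \<noteq> 0) \<and>
    (\<forall>i. (\<Sum>j\<in>UNIV. (x * A i j + y * B i j) * v j) = 0)"
proof -
  have "\<exists>x y. (x \<noteq> 0 \<or> y \<noteq> 0) \<and> det (\<chi> i j. x * A i j + y * B i j) = 0"
  proof (cases "\<exists>t. det (\<chi> i j. A i j + t * B i j) = 0")
    case True
    then obtain t where "det (\<chi> i j. A i j + t * B i j) = 0" ..
    thus ?thesis by (intro exI[of _ 1] exI[of _ t]) simp
  next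
    case False
    \<comment> \<open>\<open>det (A + t B)\<close> is a constant \<open>c\<close>, so \<open>det (B + s A) = s ^ n * c\<close>, which at \<open>s = 0\<close> gives \<open>det B = 0\<close>.\<close>
    define p where "p = det (\<chi> i j. [:A i j, B i j:])"
    define q where "q = det (\<chi> i j. [:B i j, A i j:])"
    have "degree p = 0"
      using alg_closed_imp_poly_has_root[of p] False by (simp add: p_def poly_det_pencil) blast
    then obtain c where c: "p = [:c:]" by (metis degree_0_id)
    have "poly (q - monom c CARD('n)) s = 0" if "s \<noteq> 0" for s
    proof -
      have "s * (A i j + inverse s * B i j) = B i j + s * A i j" for i j
        using that by (simp add: field_simps)
      hence "poly q s = det (\<chi> i. s *s (\<chi> j. A i j + inverse s * B i j))"
        by (simp add: q_def poly_det_pencil vector_scalar_mult_def)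
      also have "\<dots> = s ^ CARD('n) * poly p (inverse s)"
        by (subst det_rows_mul) (simp add: p_def poly_det_pencil)
      finally show ?thesis by (simp add: c poly_monom)
    qed
    hence "UNIV - {0} \<subseteq> {s. poly (q - monom c CARD('n)) s = 0}" by auto
    hence "infinite {s. poly (q - monom c CARD('n)) s = 0}"
      using infinite_UNIV_char_0[where 'a='k] by (metis finite.emptyI finite_Diff2 finite_insert finite_subset)
    hence "q - monom c CARD('n) = 0" using poly_roots_finite by blast
    \<comment> \<open>\<open>CARD('n)\<close> is positive, so the monomial vanishes at
      \<open>0\<close>.\<close>
    hence "poly q 0 = 0" by (simp add: poly_monom eq_iff_diff_eq_0[symmetric])
    thus ?thesis by (intro exI[of _ 0] exI[of _ 1]) (simp add: q_def poly_det_pencil)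
  qed
  then obtain x y where xy: "x \<noteq> 0 \<or> y \<noteq> 0" "det (\<chi> i j. x * A i j + y * B i j) = 0" by blast
  then obtain v where v: "v \<noteq> 0" "(\<chi> i j. x * A i j + y * B i j) *v v = 0"
    using singular_matrix_kernel by blast
  have "\<exists>j. v $ j \<noteq> 0" using v(1) by (auto simp: vec_eq_iff)
  moreover have "\<forall>i. (\<Sum>j\<in>UNIV. (x * A i j + y * B i j) * v $ j) = 0"
    using v(2) by (simp add: vec_eq_iff matrix_vector_mult_def)
  ultimately show ?thesis using xy(1) by blast
qed

section \<open>Contraction of forms by powers of linear forms\<close>

lemma subspace_forms: "mpoly.subspace (forms d :: ('x::finite, 'k::field) mpoly set)"
  unfolding mpoly.subspace_def forms_def
  by (auto simp: in_keys_iff lookup_add)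

text \<open>Binomial expansion in \<open>t\<close>, of which only polynomiality and the linear
  coefficient are recorded: the former bounds exceptional parameters on a line, the latter drives
  polarization. For \<open>k = 0\<close> the truncated exponent \<open>k - 1\<close> is harmless, as
  the factor \<open>of_nat k\<close> is zero.\<close>

lemma contraction_mscale_add_power:
  fixes p q h :: "('x::finite, 'k::field_char_0) mpoly"
  shows "\<exists>P. (\<forall>t. poly P t = Poly_Mapping.lookup (contraction ((p + mscale t q) ^ k) h) m) \<and>
    coeff P 1 = of_nat k * Poly_Mapping.lookup (contraction (p ^ (k - 1) * q) h) m"
proof (induction k arbitrary: h)
  case 0
  show ?case by (rule exI[of _ "[:Poly_Mapping.lookup h m:]"]) (simp add: contraction_one)
next
  case (Suc k)
  obtain P Q where
    P: "\<And>t. poly P t = Poly_Mapping.lookup (contraction ((p + mscale t q) ^ k) (contraction p h)) m"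
      "coeff P 1 = of_nat k * Poly_Mapping.lookup (contraction (p ^ (k - 1) * q) (contraction p h)) m" and
    Q: "\<And>t. poly Q t = Poly_Mapping.lookup (contraction ((p + mscale t q) ^ k) (contraction q h)) m"
    using Suc.IH[of "contraction p h"] Suc.IH[of "contraction q h"] by blast
  have "coeff Q 0 = Poly_Mapping.lookup (contraction (p ^ k * q) h) m"
    using Q[of 0] by (simp add: poly_0_coeff_0 mscale_simps contraction_mult)
  moreover have "of_nat k * Poly_Mapping.lookup (contraction (p ^ (k - 1) * q) (contraction p h)) m =
      of_nat k * Poly_Mapping.lookup (contraction (p ^ k * q) h) m"
    by (cases k) (simp_all add: ac_simps flip: contraction_mult)
  \<comment> \<open>Splitting one factor \<open>p + t q\<close> off the power gives
    \<open>P + t Q\<close>. The constant term of \<open>Q\<close> supplies the missing summand of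
    the linear coefficient.\<close>
  ultimately have "coeff (P + [:0, 1:] * Q) 1 =
      of_nat (Suc k) * Poly_Mapping.lookup (contraction (p ^ (Suc k - 1) * q) h) m"
    using P(2) by (simp add: algebra_simps)
  moreover have "poly (P + [:0, 1:] * Q) t =
      Poly_Mapping.lookup (contraction ((p + mscale t q) ^ Suc k) h) m" for t
  proof -
    have "contraction ((p + mscale t q) ^ Suc k) h =
        contraction ((p + mscale t q) ^ k) (contraction (p + mscale t q) h)"
      by (simp only: power_Suc2 contraction_mult)
    also have "\<dots> = contraction ((p + mscale t q) ^ k) (contraction p h) +
        mscale t (contraction ((p + mscale t q) ^ k) (contraction q h))"
      by (simp add: contraction_add contraction_mscale contraction_add_right contraction_mscale_right)
    finally show ?thesis by (simp add: P(1) Q lookup_add)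
  qed
  ultimately show ?case by blast
qed

lemma partial_in_forms:
  assumes "h \<in> forms (Suc d)"
  shows "partial i h \<in> forms d"
  unfolding forms_def
proof (intro CollectI ballI)
  fix m assume "m \<in> Poly_Mapping.keys (partial i h)"
  hence "m + Poly_Mapping.single i 1 \<in> Poly_Mapping.keys h"
    by (auto simp: in_keys_iff lookup_partial)
  hence "(\<Sum>j\<in>UNIV. Poly_Mapping.lookup (m + Poly_Mapping.single i 1) j) = Suc d"
    using assms by (auto simp: forms_def)
  thus "(\<Sum>j\<in>UNIV. Poly_Mapping.lookup m j) = d"
    by (simp add: lookup_add lookup_single sum.distrib when_def)
qed

lemma var_in_forms: "var i \<in> forms 1"
  by (auto simp: forms_def var_def lookup_single when_def)

lemma contraction_in_forms:
  fixes l :: "('x::finite, 'k::field) mpoly"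
  assumes "l \<in> forms 1" "h \<in> forms (Suc d)"
  shows "contraction l h \<in> forms d"
proof -
  have "l \<in> mpoly.span (range var)" using assms(1) by (simp only: forms_1_eq_span)
  thus ?thesis
  proof (induction rule: mpoly.span_induct_alt)
    case base
    show ?case by (simp add: contraction_zero mpoly.subspace_0[OF subspace_forms])
  next
    case (step c x y)
    thus ?case using partial_in_forms[OF assms(2)]
      by (auto simp: contraction_add contraction_mscale contraction_var
          intro!: mpoly.subspace_add[OF subspace_forms] mpoly.subspace_scale[OF subspace_forms])
  qed
qed

text \<open>A monomial of positive degree contains some variable; differentiating by it multiplies
  the coefficient by a positive integer, which is nonzero in characteristic 0.\<close>

lemma form_eq_0_if_partials_eq_0:
  fixes h :: "('x::finite, 'k::field_char_0) mpoly"
  assumes "h \<in> forms (Suc d)" "\<And>i. partial i h = 0"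
  shows "h = 0"
proof (rule ccontr)
  assume "h \<noteq> 0"
  then obtain m where m: "m \<in> Poly_Mapping.keys h" by fastforce
  hence "(\<Sum>i\<in>UNIV. Poly_Mapping.lookup m i) = Suc d" using assms(1) by (auto simp: forms_def)
  then obtain i where i: "Poly_Mapping.lookup m i \<noteq> 0" by (metis nat.distinct(1) sum.neutral)
  define m' where "m' = m - Poly_Mapping.single i 1"
  have m': "m = m' + Poly_Mapping.single i 1" using i unfolding m'_def
    by (intro poly_mapping_eqI) (auto simp: lookup_add lookup_minus lookup_single when_def)
  have "Poly_Mapping.lookup (partial i h) m' \<noteq> 0"
    unfolding lookup_partial m'[symmetric] using m by (simp add: in_keys_iff del: of_nat_Suc)
  thus False by (simp add: assms(2))
qed

text \<open>Polarization: if every \<open>l ^ Suc k\<close> annihilates \<open>h\<close>, the linear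
  coefficient in \<open>t\<close> of the contraction by \<open>(l + t x^i) ^ Suc k\<close> shows
  that every \<open>l ^ k\<close> annihilates \<open>partial i h\<close>. By induction all partial
  derivatives vanish, hence so does \<open>h\<close>.\<close>

lemma exists_contraction_power_neq_0:
  fixes h :: "('x::finite, 'k::field_char_0) mpoly"
  assumes "h \<in> forms d" "h \<noteq> 0" "k \<le> d"
  shows "\<exists>l\<in>forms 1. contraction (l ^ k) h \<noteq> 0"
  using assms
proof (induction k arbitrary: h d)
  case 0
  show ?case
    by (rule bexI[of _ 0]) (use 0 in \<open>auto simp: contraction_one forms_def\<close>)
next
  case (Suc k)
  then obtain e where d: "d = Suc e" by (cases d) auto
  show ?case
  proof (rule ccontr)
    assume "\<not> ?thesis"
    hence zero: "contraction (l ^ Suc k) h = 0" if "l \<in> forms 1" for l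
      using that by blast
    have "partial i h = 0" for i
    proof (rule ccontr)
      assume "partial i h \<noteq> 0"
      then obtain l where l: "l \<in> forms 1" "contraction (l ^ k) (partial i h) \<noteq> 0"
        using Suc.IH[OF partial_in_forms[of h e i]] Suc.prems d by auto
      then obtain m where m: "Poly_Mapping.lookup (contraction (l ^ k * var i) h) m \<noteq> 0"
        by (metis contraction_mult contraction_var lookup_zero poly_mapping_eqI)
      obtain P where P: "\<And>t. poly P t = Poly_Mapping.lookup (contraction ((l + mscale t (var i)) ^ Suc k) h) m"
        "coeff P 1 = of_nat (Suc k) * Poly_Mapping.lookup (contraction (l ^ (Suc k - 1) * var i) h) m"
        using contraction_mscale_add_power by blast
      have "l + mscale t (var i) \<in> forms 1" for t
        using l(1) var_in_forms
        by (intro mpoly.subspace_add[OF subspace_forms] mpoly.subspace_scale[OF subspace_forms])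
      hence "poly P = poly 0" by (auto simp: P(1) zero simp del: power_Suc)
      hence "P = 0" by (simp only: poly_eq_poly_eq_iff)
      with P(2) m show False by (simp del: of_nat_Suc)
    qed
    thus False using form_eq_0_if_partials_eq_0 Suc.prems d by blast
  qed
qed

section \<open>Linear algebra in the three-dimensional space of linear forms\<close>

lemma mscale_mult: "mscale c p * q = mscale c (p * q)" "p * mscale c q = mscale c (p * q)"
  by (simp_all add: mscale_def ac_simps)

lemma forms_1_not_subset_span:
  assumes "CARD('x::finite) = 3" "finite S" "card S \<le> 2"
  shows "\<exists>p\<in>forms 1. p \<notin> mpoly.span (S :: ('x, 'k::field) mpoly set)"
proof (rule ccontr)
  assume "\<not> ?thesis"
  hence "range var \<subseteq> mpoly.span S" using var_in_forms by blast
  hence "card (range (var :: 'x \<Rightarrow> ('x, 'k) mpoly)) \<le> card S"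
    using mpoly.independent_span_bound[OF assms(2) independent_var] by blast
  thus False using assms(1,3) by (simp add: card_image[OF inj_var])
qed

text \<open>Otherwise \<open>a\<close>, \<open>b\<close>, \<open>c\<close>, \<open>v\<close> would
  be four independent vectors in a space of dimension 3.\<close>

lemma forms_1_subset_span:
  fixes a b c v :: "('x::finite, 'k::field) mpoly"
  assumes "CARD('x) = 3" "a \<in> forms 1" "b \<in> forms 1" "c \<in> forms 1" "v \<in> forms 1"
    and "a \<noteq> 0" "b \<notin> mpoly.span {a}" "c \<notin> mpoly.span {a, b}"
  shows "v \<in> mpoly.span {a, b, c}"
proof (rule ccontr)
  assume v: "v \<notin> mpoly.span {a, b, c}"
  have "mpoly.independent {a}"
    using mpoly.independent_insertI[OF _ mpoly.independent_empty, of a] assms(6) by simp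
  hence "mpoly.independent {b, a}" by (rule mpoly.independent_insertI[OF assms(7)])
  hence "mpoly.independent {a, b}" by (subst insert_commute)
  hence "mpoly.independent {c, a, b}" by (rule mpoly.independent_insertI[OF assms(8)])
  moreover have "{c, a, b} = {a, b, c}" by blast
  ultimately have "mpoly.independent {a, b, c}" by simp
  hence i: "mpoly.independent {v, a, b, c}" by (rule mpoly.independent_insertI[OF v])
  have "v \<notin> {a, b, c}" "c \<notin> {a, b}" "b \<notin> {a}"
    using assms(7,8) v by (auto simp: mpoly.span_base)
  hence "card {v, a, b, c} = 4" by auto
  moreover have "{v, a, b, c} \<subseteq> mpoly.span (range var)"
    using assms(2-5) unfolding forms_1_eq_span by (intro insert_subsetI empty_subsetI)
  hence "card {v, a, b, c} \<le> card (range (var :: 'x \<Rightarrow> ('x, 'k) mpoly))"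
    by (intro conjunct2[OF mpoly.independent_span_bound[OF _ i]]) simp
  ultimately show False using assms(1) by (simp add: card_image[OF inj_var])
qed

text \<open>Equality of projective points is expressed below by a nonzero vector lying in the span
  of another; this is the symmetry of that relation.\<close>

lemma in_span_singleton_commute:
  "v \<in> mpoly.span {w} \<Longrightarrow> v \<noteq> 0 \<Longrightarrow> w \<in> mpoly.span {v}"
  using mpoly.in_span_insert[of v w "{}"] by simp

section \<open>Generic linear forms\<close>

text \<open>Two distinct parameters would put a nonzero multiple of \<open>q\<close>, hence
  \<open>q\<close> and then \<open>p\<close>, into \<open>W\<close>. So at most one parameter
  occurs.\<close>

lemma finite_line_in_subspace:
  fixes p q :: "('x::finite, 'k::field) mpoly"
  assumes W: "mpoly.subspace W" and "\<not> (p \<in> W \<and> q \<in> W)"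
  shows "finite {t. p + mscale t q \<in> W}"
proof -
  have "t = u" if t: "p + mscale t q \<in> W" and u: "p + mscale u q \<in> W" for t u
  proof (rule ccontr)
    assume "t \<noteq> u"
    have "(p + mscale t q) - (p + mscale u q) \<in> W" using W t u by (rule mpoly.subspace_diff)
    hence "mscale (t - u) q \<in> W" by (simp add: mpoly.scale_left_diff_distrib)
    hence "mscale (inverse (t - u)) (mscale (t - u) q) \<in> W" by (rule mpoly.subspace_scale[OF W])
    hence q: "q \<in> W" using \<open>t \<noteq> u\<close> by simp
    hence "(p + mscale t q) - mscale t q \<in> W"
      by (intro mpoly.subspace_diff[OF W t] mpoly.subspace_scale[OF W])
    with q assms(2) show False by simp
  qed
  hence "{t. p + mscale t q \<in> W} = {} \<or> (\<exists>t. {t. p + mscale t q \<in> W} = {t})" by blast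
  thus ?thesis by (metis finite.emptyI finite_insert)
qed

text \<open>
  A substitute for nonempty Zariski open subsets of \<open>S\<^sup>1\<close>: the condition along lines suffices for
  intersecting finitely many of them.
\<close>

definition generic :: "('x::finite, 'k::field) mpoly set \<Rightarrow> bool" where
  "generic U \<longleftrightarrow> (\<exists>p\<in>forms 1. p \<in> U) \<and>
    (\<forall>p\<in>forms 1 \<inter> U. \<forall>q\<in>forms 1. finite {t. p + mscale t q \<notin> U})"

text \<open>Join a point of \<open>U\<close> to a point of \<open>V\<close> by a line: all but
  finitely many of its points lie in both sets, and the field is infinite.\<close>

lemma generic_Int:
  fixes U V :: "('x::finite, 'k::field_char_0) mpoly set"
  assumes U: "generic U" and V: "generic V"
  shows "generic (U \<inter> V)"
  unfolding generic_def
proof (intro conjI ballI)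
  obtain p q where p: "p \<in> forms 1" "p \<in> U" and q: "q \<in> forms 1" "q \<in> V"
    using U V unfolding generic_def by blast
  have diff: "q - p \<in> forms 1" "p - q \<in> forms 1"
    using p q mpoly.subspace_diff[OF subspace_forms] by blast+
  have "finite {t. p + mscale t (q - p) \<notin> U}"
    using U p diff unfolding generic_def by blast
  moreover have "finite {t. q + mscale t (p - q) \<notin> V}"
    using V q diff unfolding generic_def by blast
  \<comment> \<open>Seen from \<open>q\<close> instead of \<open>p\<close>, the same line carries
    the parameter \<open>1 - t\<close>.\<close>
  hence "finite ((\<lambda>t. 1 - t) ` {t. q + mscale t (p - q) \<notin> V})" by (rule finite_imageI)
  ultimately have "finite ({t. p + mscale t (q - p) \<notin> U} \<union>
      (\<lambda>t. 1 - t) ` {t. q + mscale t (p - q) \<notin> V})" by (rule finite_UnI)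
  then obtain t where t: "t \<notin> {t. p + mscale t (q - p) \<notin> U}"
      "t \<notin> (\<lambda>t. 1 - t) ` {t. q + mscale t (p - q) \<notin> V}"
    using ex_new_if_finite[OF infinite_UNIV_char_0[where 'a='k]] by blast
  have "q + mscale (1 - t) (p - q) \<in> V"
  proof (rule ccontr)
    assume "\<not> ?thesis"
    hence "1 - (1 - t) \<in> (\<lambda>t. 1 - t) ` {t. q + mscale t (p - q) \<notin> V}" by blast
    with t(2) show False by simp
  qed
  moreover have "q + mscale (1 - t) (p - q) = p + mscale t (q - p)"
    by (simp add: mpoly.scale_left_diff_distrib mpoly.scale_right_diff_distrib algebra_simps)
  ultimately have "p + mscale t (q - p) \<in> U \<inter> V" using t(1) by simp
  moreover have "p + mscale t (q - p) \<in> forms 1"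
    using p diff by (intro mpoly.subspace_add[OF subspace_forms] mpoly.subspace_scale[OF subspace_forms])
  ultimately show "\<exists>p\<in>forms 1. p \<in> U \<inter> V" by blast
next
  fix p q :: "('x, 'k) mpoly"
  assume "p \<in> forms 1 \<inter> (U \<inter> V)" "q \<in> forms 1"
  hence "finite ({t. p + mscale t q \<notin> U} \<union> {t. p + mscale t q \<notin> V})"
    using U V unfolding generic_def by blast
  thus "finite {t. p + mscale t q \<notin> U \<inter> V}" by (rule rev_finite_subset) auto
qed

lemma generic_Inter:
  fixes \<U> :: "('x::finite, 'k::field_char_0) mpoly set set"
  assumes "finite \<U>" "\<And>U. U \<in> \<U> \<Longrightarrow> generic U"
  shows "generic (\<Inter>\<U>)"
  using assms
proof (induction \<U>)
  case empty
  have "0 \<in> forms 1" by (simp add: forms_def)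
  thus ?case by (auto simp: generic_def)
next
  case (insert U \<U>)
  thus ?case by (simp add: generic_Int)
qed

lemma generic_Compl_span:
  fixes S :: "('x::finite, 'k::field) mpoly set"
  assumes "CARD('x) = 3" "finite S" "card S \<le> 2"
  shows "generic (- mpoly.span S)"
  using forms_1_not_subset_span[OF assms] finite_line_in_subspace[OF mpoly.subspace_span, of _ S]
  by (auto simp: generic_def)

text \<open>Follow one coefficient that is nonzero at \<open>p\<close>: along a line through
  \<open>p\<close> it is a polynomial in \<open>t\<close> with nonzero value at \<open>0\<close>, so
  it has finitely many roots.\<close>

lemma generic_contraction_power_neq_0:
  fixes h :: "('x::finite, 'k::field_char_0) mpoly"
  assumes "h \<in> forms d" "h \<noteq> 0" "k \<le> d"
  shows "generic {l. contraction (l ^ k) h \<noteq> 0}"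
  unfolding generic_def
proof (intro conjI ballI)
  show "\<exists>p\<in>forms 1. p \<in> {l. contraction (l ^ k) h \<noteq> 0}"
    using exists_contraction_power_neq_0[OF assms] by blast
next
  fix p q :: "('x, 'k) mpoly"
  assume "p \<in> forms 1 \<inter> {l. contraction (l ^ k) h \<noteq> 0}"
  hence "contraction (p ^ k) h \<noteq> 0" by simp
  then obtain m where m: "Poly_Mapping.lookup (contraction (p ^ k) h) m \<noteq> 0"
    by (metis lookup_zero poly_mapping_eqI)
  obtain P where P: "\<And>t. poly P t = Poly_Mapping.lookup (contraction ((p + mscale t q) ^ k) h) m"
    using contraction_mscale_add_power by blast
  have "poly P 0 \<noteq> 0" using m by (simp add: P mscale_simps)
  hence "finite {t. poly P t = 0}" by (intro poly_roots_finite) auto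
  thus "finite {t. p + mscale t q \<notin> {l. contraction (l ^ k) h \<noteq> 0}}"
    by (rule rev_finite_subset) (auto simp: P)
qed

text \<open>Projectively, finitely many lines through \<open>a\<close> do not cover the plane. With
  \<open>a = 0\<close> the lines shrink to the points of \<open>T\<close>.\<close>

lemma exists_form_avoiding_spans:
  fixes T :: "('x::finite, 'k::field_char_0) mpoly set"
  assumes "CARD('x) = 3" "finite T"
  shows "\<exists>b\<in>forms 1. \<forall>s\<in>T. b \<notin> mpoly.span {a, s}"
proof -
  have "generic (\<Inter>s\<in>T. - mpoly.span {a, s})"
    using assms by (intro generic_Inter) (auto intro!: generic_Compl_span simp: card_insert_if)
  thus ?thesis by (auto simp: generic_def)
qed

section \<open>Vanishing of contractions and polar pairs of a plane cubic\<close>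

lemma contraction_eq_0_on_span:
  assumes "\<And>v. v \<in> S \<Longrightarrow> contraction v g = 0" "v \<in> mpoly.span S"
  shows "contraction v g = 0"
  using assms(2)
  by (induction rule: mpoly.span_induct_alt)
    (simp_all add: assms(1) contraction_zero contraction_add contraction_mscale mscale_simps)

text \<open>Contractions with a spanning set determine all partial derivatives. For a cubic
  \<open>f\<close> this reduces \<open>contraction (l * l') f = 0\<close> to scalar
  equations.\<close>

lemma linear_form_eq_0:
  fixes g :: "('x::finite, 'k::field_char_0) mpoly"
  assumes "g \<in> forms 1" "\<And>v. v \<in> S \<Longrightarrow> contraction v g = 0" "forms 1 \<subseteq> mpoly.span S"
  shows "g = 0"
proof (rule form_eq_0_if_partials_eq_0)
  show "g \<in> forms (Suc 0)" using assms(1) by simp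
  show "partial i g = 0" for i
    using contraction_eq_0_on_span[of S g "var i"] assms(2,3) var_in_forms[of i]
    by (auto simp flip: contraction_var)
qed

lemma contraction2_in_forms:
  fixes a b f :: "('x::finite, 'k::field) mpoly"
  assumes "a \<in> forms 1" "b \<in> forms 1" "f \<in> forms (d + 2)"
  shows "contraction (a * b) f \<in> forms d"
  unfolding contraction_mult
  by (intro contraction_in_forms assms(1,2)) (use assms(3) in simp)

text \<open>The polar conics of \<open>a\<close> and \<open>b\<close>, evaluated on the family
  \<open>w\<close>, give two square matrices; the kernel vector of a singular member of their pencil
  is \<open>v\<close>. The index type is free, so that \<open>w\<close> can be the full basis or
  just two vectors.\<close>

lemma polar_pencil:
  fixes a b f :: "('x::finite, 'k::{alg_closed_field, field_char_0}) mpoly"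
    and w :: "'n::finite \<Rightarrow> ('x, 'k) mpoly"
  assumes "a \<in> forms 1" "b \<in> forms 1" "\<And>i. w i \<in> forms 1" "f \<in> forms 3"
  shows "\<exists>x y v. (x \<noteq> 0 \<or> y \<noteq> 0) \<and> (\<exists>j. v j \<noteq> 0) \<and>
    (\<forall>i. contraction ((mscale x a + mscale y b) * (\<Sum>j\<in>UNIV. mscale (v j) (w j)) * w i) f = 0)"
proof -
  \<comment> \<open>\<open>F\<close> is the symmetric trilinear form of the cubic. On linear forms
    its values are constant polynomials, which are read off at the monomial
    \<open>0\<close>.\<close>
  define F where "F p q r = contraction (p * q * r) f" for p q r
  obtain x y v where xy: "x \<noteq> 0 \<or> y \<noteq> 0" and v: "\<exists>j. v j \<noteq> 0" and
    sum: "\<And>i. (\<Sum>j\<in>UNIV. (x * Poly_Mapping.lookup (F a (w j) (w i)) 0 +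
      y * Poly_Mapping.lookup (F b (w j) (w i)) 0) * v j) = 0"
    using singular_member_of_pencil[of "\<lambda>i j. Poly_Mapping.lookup (F a (w j) (w i)) 0"
        "\<lambda>i j. Poly_Mapping.lookup (F b (w j) (w i)) 0"] by blast
  have "contraction ((mscale x a + mscale y b) * (\<Sum>j\<in>UNIV. mscale (v j) (w j)) * w i) f = 0" for i
  proof (rule poly_mapping_eqI)
    fix m :: "'x \<Rightarrow>\<^sub>0 nat"
    have F: "F p (w j) (w i) \<in> forms 0" if "p \<in> forms 1" for p j
      unfolding F_def mult.assoc contraction_mult[of p]
      by (rule contraction_in_forms[OF that], rule contraction2_in_forms) (use assms(3,4) in \<open>simp_all add: numeral_3_eq_3\<close>)
    have "contraction ((mscale x a + mscale y b) * (\<Sum>j\<in>UNIV. mscale (v j) (w j)) * w i) f =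
        (\<Sum>j\<in>UNIV. mscale (v j) (mscale x (F a (w j) (w i)) + mscale y (F b (w j) (w i))))"
      by (simp add: F_def sum_distrib_left sum_distrib_right contraction_sum mscale_mult distrib_right
          contraction_add contraction_mscale mscale_simps)
    hence eq: "Poly_Mapping.lookup (contraction ((mscale x a + mscale y b) *
        (\<Sum>j\<in>UNIV. mscale (v j) (w j)) * w i) f) m =
        (\<Sum>j\<in>UNIV. (x * Poly_Mapping.lookup (F a (w j) (w i)) m +
          y * Poly_Mapping.lookup (F b (w j) (w i)) m) * v j)"
      by (simp add: lookup_sum lookup_add mult.commute)
    show "Poly_Mapping.lookup (contraction ((mscale x a + mscale y b) *
        (\<Sum>j\<in>UNIV. mscale (v j) (w j)) * w i) f) m = Poly_Mapping.lookup 0 m"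
    proof (cases "m = 0")
      case True
      thus ?thesis unfolding eq by (simp add: sum)
    next
      case False
      have "Poly_Mapping.lookup h m = 0" if "h \<in> forms 0" for h :: "('x, 'k) mpoly"
      proof (rule ccontr)
        assume "Poly_Mapping.lookup h m \<noteq> 0"
        hence "(\<Sum>i\<in>UNIV. Poly_Mapping.lookup m i) = 0" using that by (auto simp: forms_def in_keys_iff)
        hence "m = 0" by (intro poly_mapping_eqI) simp
        with False show False by simp
      qed
      thus ?thesis using F assms(1,2) by (simp add: eq)
    qed
  qed
  thus ?thesis using xy v by blast
qed

lemma lookup_sum_var:
  fixes v :: "'x::finite \<Rightarrow> 'k::comm_ring_1"
  shows "Poly_Mapping.lookup (\<Sum>j\<in>UNIV. mscale (v j) (var j)) (Poly_Mapping.single i 1) = v i"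
proof -
  have *: "Poly_Mapping.lookup (var j) (Poly_Mapping.single i 1) = (if j = i then 1 else 0 :: 'k)" for j
    by (auto simp: var_def lookup_single when_def poly_mapping_eq_iff fun_eq_iff split: if_splits)
  have "Poly_Mapping.lookup (\<Sum>j\<in>UNIV. mscale (v j) (var j)) (Poly_Mapping.single i 1) =
      (\<Sum>j\<in>UNIV. if j = i then v j else 0)"
    unfolding lookup_sum lookup_mscale * by (intro sum.cong) auto
  thus ?thesis by simp
qed

text \<open>On a line that misses \<open>T\<close>, some point \<open>l\<close> has a polar conic
  singular at a point \<open>l'\<close>. Only \<open>l\<close> is kept off \<open>T\<close>.\<close>

lemma exists_polar_pair:
  fixes f :: "('x::finite, 'k::{alg_closed_field, field_char_0}) mpoly"
  assumes card: "CARD('x) = 3" and f: "f \<in> forms 3" and T: "finite T"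
  shows "\<exists>l\<in>forms 1. \<exists>l'\<in>forms 1. l \<noteq> 0 \<and> l' \<noteq> 0 \<and>
    (\<forall>s\<in>T. l \<notin> mpoly.span {s}) \<and> contraction (l * l') f = 0"
proof -
  \<comment> \<open>Including \<open>0\<close> makes \<open>a\<close> nonzero and \<open>b\<close>
    independent of \<open>a\<close>, and later gives \<open>l \<noteq> 0\<close>.\<close>
  have T0: "finite (insert 0 T)" using T by simp
  obtain a where a: "a \<in> forms 1" "\<And>s. s \<in> insert 0 T \<Longrightarrow> a \<notin> mpoly.span {0, s}"
    using exists_form_avoiding_spans[OF card T0] by blast
  obtain b where b: "b \<in> forms 1" "\<And>s. s \<in> insert 0 T \<Longrightarrow> b \<notin> mpoly.span {a, s}"
    using exists_form_avoiding_spans[OF card T0] by blast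
  obtain x y v where xy: "x \<noteq> 0 \<or> y \<noteq> 0" and v: "\<exists>j. v j \<noteq> 0" and
    zero: "\<And>i. contraction ((mscale x a + mscale y b) * (\<Sum>j\<in>UNIV. mscale (v j) (var j)) * var i) f = 0"
    using polar_pencil[where w = var, OF a(1) b(1) var_in_forms f] by blast
  define l where "l = mscale x a + mscale y b"
  define l' where "l' = (\<Sum>j\<in>UNIV. mscale (v j) (var j))"
  note zero = zero[folded l_def l'_def]
  have l: "l \<in> forms 1" unfolding l_def
    by (intro mpoly.subspace_add[OF subspace_forms] mpoly.subspace_scale[OF subspace_forms] a(1) b(1))
  have l': "l' \<in> forms 1" unfolding l'_def
    by (intro mpoly.subspace_sum[OF subspace_forms] mpoly.subspace_scale[OF subspace_forms] var_in_forms)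
  obtain j where "v j \<noteq> 0" using v ..
  hence "l' \<noteq> 0" using lookup_sum_var[of v j] by (auto simp: l'_def)
  \<comment> \<open>A multiple \<open>l\<close> of \<open>s\<close> would make \<open>a\<close> a
    multiple of \<open>s\<close> (if \<open>y = 0\<close>) or put \<open>b\<close> into the span of
    \<open>a\<close> and \<open>s\<close>.\<close>
  have avoid: "l \<notin> mpoly.span {s}" if s: "s \<in> insert 0 T" for s
  proof
    assume ls: "l \<in> mpoly.span {s}"
    show False
    proof (cases "y = 0")
      case True
      hence "a = mscale (inverse x) l" using xy by (simp add: l_def mscale_simps)
      hence "a \<in> mpoly.span {s}" using ls by (simp add: mpoly.span_scale)
      thus False using a(2)[OF s] by simp
    next
      case False
      hence "b = mscale (inverse y) (l - mscale x a)" by (simp add: l_def mscale_simps)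
      moreover have "l \<in> mpoly.span {a, s}"
        using ls mpoly.span_mono[of "{s}" "{a, s}"] by auto
      ultimately have "b \<in> mpoly.span {a, s}"
        by (simp add: mpoly.span_scale mpoly.span_diff mpoly.span_base)
      thus False using b(2)[OF s] by simp
    qed
  qed
  have "l \<noteq> 0" using avoid[of 0] by (auto simp: mpoly.span_zero)
  have "contraction (l * l') f = 0"
  proof (rule linear_form_eq_0)
    show "contraction (l * l') f \<in> forms 1"
      using f l l' by (intro contraction2_in_forms) (simp_all add: numeral_3_eq_3)
    show "contraction u (contraction (l * l') f) = 0" if "u \<in> range var" for u
    proof -
      from that obtain i where "u = var i" ..
      thus ?thesis using zero[of i] by (simp only: contraction_mult[symmetric] mult.commute[of "var i"])
    qed
    show "forms 1 \<subseteq> mpoly.span (range var :: ('x, 'k) mpoly set)" by (simp only: forms_1_eq_span)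
  qed
  with l l' \<open>l \<noteq> 0\<close> \<open>l' \<noteq> 0\<close> avoid show ?thesis by blast
qed

section \<open>Cubics with a polar conic of rank one\<close>

text \<open>The whole line through \<open>w\<close> and \<open>s\<close> is polar to
  \<open>w'\<close>, and it is infinite, so one of its points avoids \<open>T\<close> and
  \<open>w'\<close>.\<close>

lemma exists_polar_pair_on_line:
  fixes f :: "('x::finite, 'k::{alg_closed_field, field_char_0}) mpoly"
  assumes "CARD('x) = 3" "f \<in> forms 3" "finite T" "w \<in> forms 1" "w' \<in> forms 1" "s \<in> forms 1"
    and "w \<noteq> 0" "w' \<noteq> 0" "s \<notin> mpoly.span {w}"
    and "contraction (w * w') f = 0" "contraction (s * w') f = 0"
    and "\<And>t. t \<in> T \<Longrightarrow> w' \<notin> mpoly.span {t}"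
  shows "\<exists>l\<in>forms 1. \<exists>l'\<in>forms 1. l \<noteq> 0 \<and> l' \<noteq> 0 \<and> l \<notin> mpoly.span {l'} \<and>
    (\<forall>t\<in>T. l \<notin> mpoly.span {t} \<and> l' \<notin> mpoly.span {t}) \<and> contraction (l * l') f = 0"
proof -
  have "finite {u. w + mscale u s \<in> mpoly.span {t}}" for t
  proof (rule finite_line_in_subspace[OF mpoly.subspace_span], rule notI, elim conjE)
    assume w: "w \<in> mpoly.span {t}" and s: "s \<in> mpoly.span {t}"
    have "t \<in> mpoly.span {w}" using w assms(7) by (rule in_span_singleton_commute)
    hence "mpoly.span {t} \<subseteq> mpoly.span {w}" by (intro mpoly.span_minimal) auto
    with s assms(9) show False by auto
  qed
  hence "finite (\<Union>t\<in>insert w' T. {u. w + mscale u s \<in> mpoly.span {t}})"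
    using assms(3) by blast
  then obtain u where u: "\<And>t. t \<in> insert w' T \<Longrightarrow> w + mscale u s \<notin> mpoly.span {t}"
    using ex_new_if_finite[OF infinite_UNIV_char_0[where 'a='k]] by blast
  define l where "l = w + mscale u s"
  have "l \<in> forms 1" unfolding l_def
    using assms(4,6) by (intro mpoly.subspace_add[OF subspace_forms] mpoly.subspace_scale[OF subspace_forms])
  moreover have "l \<noteq> 0" using u[of w'] by (auto simp: l_def mpoly.span_zero)
  moreover have "contraction (l * w') f = 0"
    using assms(10,11)
    by (simp add: l_def distrib_right mscale_mult contraction_add contraction_mscale mscale_simps)
  ultimately show ?thesis using assms(5,8,12) u unfolding l_def by (metis insertCI)
qed

text \<open>The pencil on the span of \<open>a\<close> and \<open>b\<close> gives \<open>w0\<close>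
  and \<open>w1\<close> polar for the binary cubic, and for \<open>f\<close> too because
  \<open>s\<close> is polar to both. Each of them is then polar to the line through the other and
  \<open>s\<close>. One that avoids \<open>T\<close> is kept, and the other is moved along its
  line.\<close>

lemma exists_polar_pair_if_rank_1:
  fixes f :: "('x::finite, 'k::{alg_closed_field, field_char_0}) mpoly"
  assumes card: "CARD('x) = 3" and f: "f \<in> forms 3" and T: "finite T" "T \<subseteq> forms 1"
    and nz: "\<And>s t. s \<in> T \<Longrightarrow> t \<in> T \<Longrightarrow> contraction (s * t) f \<noteq> 0"
    and s: "s \<in> T" and a: "a \<in> forms 1" "a \<noteq> 0" and b: "b \<in> forms 1" "b \<notin> mpoly.span {a}"
    and zero: "contraction (a * s) f = 0" "contraction (b * s) f = 0"
  shows "\<exists>l\<in>forms 1. \<exists>l'\<in>forms 1. l \<noteq> 0 \<and> l' \<noteq> 0 \<and> l \<notin> mpoly.span {l'} \<and>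
    (\<forall>t\<in>T. l \<notin> mpoly.span {t} \<and> l' \<notin> mpoly.span {t}) \<and> contraction (l * l') f = 0"
proof -
  have sV: "s \<in> forms 1" using s T(2) by blast
  have zero_W: "contraction (u * s) f = 0" if "u \<in> mpoly.span {a, b}" for u
    unfolding contraction_mult
    by (rule contraction_eq_0_on_span[OF _ that]) (use zero in \<open>auto simp: contraction_mult\<close>)
  \<comment> \<open>Otherwise \<open>s * s\<close> would annihilate \<open>f\<close>, against
    \<open>nz\<close>.\<close>
  have s_notin: "s \<notin> mpoly.span {a, b}" using zero_W[of s] nz[OF s s] by blast
  \<comment> \<open>The type \<open>bool\<close> serves as a two-element index set.\<close>
  define w where "w i = (if i then a else b)" for i
  have "w i \<in> forms 1" for i using a b by (simp add: w_def)
  from polar_pencil[where w = w, OF a(1) b(1) this f] obtain x y v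
    where xy: "x \<noteq> 0 \<or> y \<noteq> 0" and v: "\<exists>j. v j \<noteq> 0" and
    pencil: "\<And>i. contraction ((mscale x a + mscale y b) * (\<Sum>j\<in>UNIV. mscale (v j) (w j)) * w i) f = 0"
    by blast
  define w0 where "w0 = mscale x a + mscale y b"
  define w1 where "w1 = mscale (v True) a + mscale (v False) b"
  have w1_eq: "(\<Sum>j\<in>UNIV. mscale (v j) (w j)) = w1"
    by (simp add: UNIV_bool w_def w1_def add.commute)
  have in_W: "mscale x a + mscale y b \<in> mpoly.span {a, b}" for x y
    by (intro mpoly.span_add mpoly.span_scale mpoly.span_base) auto
  have in_V: "mscale x a + mscale y b \<in> forms 1" for x y
    using a b by (intro mpoly.subspace_add[OF subspace_forms] mpoly.subspace_scale[OF subspace_forms])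
  have nonzero: "mscale x a + mscale y b \<noteq> 0" if "x \<noteq> 0 \<or> y \<noteq> 0" for x y
  proof
    assume eq: "mscale x a + mscale y b = 0"
    show False
    proof (cases "y = 0")
      case True
      thus False using eq that a(2) by (simp add: mscale_simps)
    next
      case False
      have "mscale y b = mscale (- x) a" using eq by (simp add: eq_neg_iff_add_eq_0 add.commute)
      hence "mscale (inverse y) (mscale y b) \<in> mpoly.span {a}"
        by (simp add: mpoly.span_neg mpoly.span_scale mpoly.span_base)
      thus False using False b(2) by (simp add: mscale_simps)
    qed
  qed
  have s_notin_line: "s \<notin> mpoly.span {u}" if "u \<in> mpoly.span {a, b}" for u
  proof -
    have "mpoly.span {u} \<subseteq> mpoly.span {a, b}" using that by (intro mpoly.span_minimal) auto
    thus ?thesis using s_notin by blast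
  qed
  have w0: "w0 \<in> forms 1" "w0 \<noteq> 0" "contraction (w0 * s) f = 0" "s \<notin> mpoly.span {w0}"
    unfolding w0_def
    by (rule in_V nonzero[OF xy] zero_W[OF in_W] s_notin_line[OF in_W])+
  have v': "v True \<noteq> 0 \<or> v False \<noteq> 0" using v by (metis (full_types))
  have w1: "w1 \<in> forms 1" "w1 \<noteq> 0" "contraction (w1 * s) f = 0" "s \<notin> mpoly.span {w1}"
    unfolding w1_def
    by (rule in_V nonzero[OF v'] zero_W[OF in_W] s_notin_line[OF in_W])+
  \<comment> \<open>The pencil gives the vanishing on \<open>a\<close> and \<open>b\<close>; on
    \<open>s\<close> it follows from \<open>w1\<close> being polar to \<open>s\<close>.\<close>
  have w01: "contraction (w0 * w1) f = 0"
  proof (rule linear_form_eq_0)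
    show "contraction (w0 * w1) f \<in> forms 1"
      using f w0(1) w1(1) by (intro contraction2_in_forms) (simp_all add: numeral_3_eq_3)
    show "forms 1 \<subseteq> mpoly.span {a, b, s}"
      using forms_1_subset_span[OF card a(1) b(1) sV _ a(2) b(2) s_notin] by blast
    show "contraction u (contraction (w0 * w1) f) = 0" if "u \<in> {a, b, s}" for u
    proof -
      have "contraction (w0 * w1 * u) f = 0"
      proof (cases "u = s")
        case True
        have "contraction (w0 * w1 * s) f = contraction w0 (contraction (w1 * s) f)"
          by (simp only: mult.assoc contraction_mult)
        thus ?thesis using w1(3) True by (simp add: contraction_zero_right)
      next
        case False
        hence "u = w True \<or> u = w False" using that by (auto simp: w_def)
        thus ?thesis using pencil by (auto simp: w1_eq simp flip: w0_def)
      qed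
      thus ?thesis by (simp add: mult.commute flip: contraction_mult)
    qed
  qed
  show ?thesis
  proof (cases "\<forall>t\<in>T. w1 \<notin> mpoly.span {t}")
    case True
    show ?thesis
      by (rule exists_polar_pair_on_line[OF card f T(1) w0(1) w1(1) sV w0(2) w1(2) w0(4) w01])
        (use w1(3) True in \<open>auto simp: mult.commute\<close>)
  next
    case False
    then obtain t where t: "t \<in> T" "w1 \<in> mpoly.span {t}" by blast
    \<comment> \<open>As \<open>w1\<close> represents a point of \<open>T\<close>, \<open>w0\<close>
      cannot: the two points would violate \<open>nz\<close>. So \<open>w0\<close> and
      \<open>w1\<close> exchange roles.\<close>
    have "w0 \<notin> mpoly.span {t'}" if "t' \<in> T" for t'
    proof
      assume "w0 \<in> mpoly.span {t'}"
      hence "t' \<in> mpoly.span {w0}" using w0(2) by (rule in_span_singleton_commute)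
      moreover have "t \<in> mpoly.span {w1}" using t(2) w1(2) by (rule in_span_singleton_commute)
      ultimately obtain c c' where "t' = mscale c w0" "t = mscale c' w1"
        by (auto simp: mpoly.span_singleton)
      hence "contraction (t' * t) f = 0"
        using w01 by (simp add: mscale_mult contraction_mscale mscale_simps)
      thus False using nz[OF that t(1)] by simp
    qed
    thus ?thesis
      by (intro exists_polar_pair_on_line[OF card f T(1) w1(1) w0(1) sV w1(2) w0(2) w1(4)])
        (use w0(3) w01 in \<open>auto simp: mult.commute\<close>)
  qed
qed

section \<open>Singular points of a plane cubic\<close>

text \<open>The points \<open>p\<close> with \<open>contraction (p * p) f = 0\<close> are the singular points of the cubic.\<close>

lemma polar_pair_among_four_singular_points:
  fixes f :: "('x::finite, 'k::field_char_0) mpoly"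
  assumes card: "CARD('x) = 3" and f: "f \<in> forms 3"
    and V: "a \<in> forms 1" "b \<in> forms 1" "c \<in> forms 1" "e \<in> forms 1"
    and "a \<noteq> 0" "b \<notin> mpoly.span {a}" "c \<notin> mpoly.span {a}" "c \<notin> mpoly.span {b}"
    and e: "e \<notin> mpoly.span {a}" "e \<notin> mpoly.span {b}" "e \<notin> mpoly.span {c}"
    and sing: "contraction (a * a) f = 0" "contraction (b * b) f = 0"
      "contraction (c * c) f = 0" "contraction (e * e) f = 0"
  shows "contraction (b * a) f = 0 \<or> contraction (c * a) f = 0 \<or> contraction (c * b) f = 0"
proof (rule ccontr)
  define B where "B p q = contraction (p * q) f" for p q
  assume "\<not> ?thesis"
  hence nz: "B a b \<noteq> 0" "B a c \<noteq> 0" "B b c \<noteq> 0" by (simp_all add: B_def mult.commute)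
  have comm: "B q p = B p q" for p q by (simp add: B_def mult.commute)
  have lin: "B (p + q) r = B p r + B q r" "B p (q + r) = B p q + B p r"
    "B (mscale k p) r = mscale k (B p r)" "B p (mscale k r) = mscale k (B p r)" for p q r k
    by (simp_all add: B_def distrib_left distrib_right mscale_mult contraction_add contraction_mscale)
  have sing': "B a a = 0" "B b b = 0" "B c c = 0" "B e e = 0" using sing by (simp_all add: B_def)
  \<comment> \<open>On the line through \<open>a\<close> and \<open>b\<close>, \<open>B c c\<close>
    is \<open>2 x y\<close> times \<open>B a b\<close>, which vanishes only at \<open>a\<close> and
    \<open>b\<close>.\<close>
  have "c \<notin> mpoly.span {a, b}"
  proof
    assume "c \<in> mpoly.span {a, b}"
    then obtain x y where c: "c = mscale x a + mscale y b"
      unfolding mpoly.span_insert[of a "{b}"] mpoly.span_singleton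
      by (auto simp: algebra_simps)
    have "B c c = mscale (2 * x * y) (B a b)"
      by (simp add: c lin sing' comm[of b a] mscale_simps mult.commute flip: mpoly.scale_left_distrib)
    hence "x = 0 \<or> y = 0" using nz sing' by simp
    thus False using c assms(9,10) by (auto simp: mscale_simps mpoly.span_scale mpoly.span_base)
  qed
  hence span: "v \<in> mpoly.span {a, b, c}" if "v \<in> forms 1" for v
    using forms_1_subset_span[OF card V(1-3) that assms(7,8)] by blast
  obtain x y where "e - mscale x a - mscale y b \<in> mpoly.span {c}"
    using span[OF V(4)] unfolding mpoly.span_insert[of a "{b, c}"] mpoly.span_insert[of b "{c}"] by blast
  then obtain z where "e - mscale x a - mscale y b = mscale z c"
    unfolding mpoly.span_singleton by blast
  hence xyz: "e = mscale x a + mscale y b + mscale z c" by (simp add: algebra_simps)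
  have B_V: "B p q \<in> forms 1" if "p \<in> forms 1" "q \<in> forms 1" for p q
    unfolding B_def by (intro contraction2_in_forms that) (use f in \<open>simp add: numeral_3_eq_3\<close>)
  define F where "F p q r = contraction r (B p q)" for p q r
  have F_comm: "F q p r = F p q r" "F p r q = F p q r" for p q r
    by (simp_all add: F_def B_def mult_ac flip: contraction_mult)
  have F_0: "F p p q = 0" if "p \<in> {a, b, c}" for p q
    using that sing' by (auto simp: F_def contraction_zero_right)
  \<comment> \<open>In the basis \<open>a\<close>, \<open>b\<close>, \<open>c\<close> the trilinear
    form has no other independent entry: the cubic is a triangle, and its singular points are the
    three vertices.\<close>
  have F_abc: "F a b c \<noteq> 0"
  proof
    assume "F a b c = 0"
    hence "contraction v (B a b) = 0" if "v \<in> {a, b, c}" for v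
      using that F_0[of a b] F_0[of b a] F_comm unfolding F_def[symmetric] by (auto; metis)
    hence "B a b = 0"
      using linear_form_eq_0[OF B_V[OF V(1,2)], of "{a, b, c}"] span by blast
    with nz show False by simp
  qed
  \<comment> \<open>Half of \<open>B e e\<close>, expanded in the coordinates of
    \<open>e\<close>.\<close>
  define w where "w = mscale (x * y) (B a b) + mscale (x * z) (B a c) + mscale (y * z) (B b c)"
  have "mscale 2 w = w + w" by (metis mpoly.scale_left_distrib mpoly.scale_one one_add_one)
  also have "\<dots> = B e e"
    by (simp add: w_def xyz lin sing' comm[of b a] comm[of c a] comm[of c b] mscale_simps algebra_simps)
  finally have eq: "mscale (x * y) (B a b) + mscale (x * z) (B a c) + mscale (y * z) (B b c) = 0"
    by (simp add: sing' w_def)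
  have F_eq: "mscale (x * y) (F a b r) + mscale (x * z) (F a c r) + mscale (y * z) (F b c r) = 0" for r
    using arg_cong[OF eq, of "contraction r"]
    by (simp add: F_def contraction_add_right contraction_mscale_right contraction_zero_right)
  have F_perm: "F a c b = F a b c" "F b c a = F a b c" "F a c c = 0" "F b c c = 0" "F a b b = 0"
    "F b c b = 0" "F a b a = 0" "F a c a = 0"
    using F_0 F_comm by (auto; metis)+
  \<comment> \<open>Contracting with \<open>c\<close>, \<open>b\<close> and \<open>a\<close>
    isolates the three coefficients. Two coordinates of \<open>e\<close> then vanish, so
    \<open>e\<close> would be a multiple of a vertex.\<close>
  have "x * y = 0" "x * z = 0" "y * z = 0"
    using F_eq[of c] F_eq[of b] F_eq[of a] F_abc by (simp_all add: F_perm mscale_simps)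
  hence "(y = 0 \<and> z = 0) \<or> (x = 0 \<and> z = 0) \<or> (x = 0 \<and> y = 0)" by auto
  thus False using xyz e by (auto simp: mscale_simps mpoly.span_scale mpoly.span_base)
qed

section \<open>Polar pairs of a cubic outside a finite set\<close>

lemma cubic_polar_pair:
  fixes f :: "('x::finite, 'k::{alg_closed_field, field_char_0}) mpoly"
  assumes card: "CARD('x) = 3" and f: "f \<in> forms 3" and T: "finite T" "T \<subseteq> forms 1"
    and nz: "\<And>s t. s \<in> T \<Longrightarrow> t \<in> T \<Longrightarrow> contraction (s * t) f \<noteq> 0"
  shows "\<exists>l\<in>forms 1. \<exists>l'\<in>forms 1. l \<noteq> 0 \<and> l' \<noteq> 0 \<and> l \<notin> mpoly.span {l'} \<and>
    (\<forall>t\<in>T. l \<notin> mpoly.span {t} \<and> l' \<notin> mpoly.span {t}) \<and> contraction (l * l') f = 0"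
proof (rule ccontr)
  assume no_pair: "\<not> ?thesis"
  \<comment> \<open>Two independent forms polar to \<open>s\<close> would give a pair by the rank
    one case.\<close>
  have "\<exists>r. \<forall>l\<in>forms 1. contraction (l * s) f = 0 \<longrightarrow> l \<in> mpoly.span {r}" if s: "s \<in> T" for s
  proof (cases "\<exists>r\<in>forms 1. r \<noteq> 0 \<and> contraction (r * s) f = 0")
    case True
    then obtain r where r: "r \<in> forms 1" "r \<noteq> 0" "contraction (r * s) f = 0" by blast
    have "l \<in> mpoly.span {r}" if "l \<in> forms 1" "contraction (l * s) f = 0" for l
    proof (rule ccontr)
      assume "l \<notin> mpoly.span {r}"
      thus False
        using exists_polar_pair_if_rank_1[OF card f T nz s r(1,2) that(1) _ r(3) that(2)] no_pair
        by blast
    qed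
    thus ?thesis by blast
  next
    case False
    \<comment> \<open>Here only the zero form is polar to \<open>s\<close>, so \<open>r = 0\<close>
      serves.\<close>
    thus ?thesis by (intro exI[of _ 0] ballI impI) (metis mpoly.span_zero)
  qed
  then obtain r where r: "\<And>s l. s \<in> T \<Longrightarrow> l \<in> forms 1 \<Longrightarrow> contraction (l * s) f = 0 \<Longrightarrow>
      l \<in> mpoly.span {r s}"
    by metis
  have singular_point: "\<exists>p\<in>forms 1. p \<noteq> 0 \<and> contraction (p * p) f = 0 \<and>
      (\<forall>t\<in>T \<union> S. p \<notin> mpoly.span {t})" if "finite S" for S
  proof -
    \<comment> \<open>Avoiding every \<open>r t\<close> keeps \<open>l'\<close> off
      \<open>T\<close>: otherwise \<open>l\<close> would be polar to \<open>t\<close>, hence a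
      multiple of \<open>r t\<close>. As no pair exists, \<open>l\<close> and \<open>l'\<close> must
      be the same point.\<close>
    have "finite (T \<union> r ` T \<union> S)" using T(1) that by simp
    then obtain l l' where l: "l \<in> forms 1" "l' \<in> forms 1" "l \<noteq> 0" "l' \<noteq> 0" "contraction (l * l') f = 0"
      "\<And>s. s \<in> T \<union> r ` T \<union> S \<Longrightarrow> l \<notin> mpoly.span {s}"
      using exists_polar_pair[OF card f, of "T \<union> r ` T \<union> S"] by blast
    have mult: "\<exists>c. v = mscale c l'" if "l' \<in> mpoly.span {v}" for v
      using in_span_singleton_commute[OF that l(4)] by (auto simp: mpoly.span_singleton)
    have polar: "contraction (l * v) f = 0" if "l' \<in> mpoly.span {v}" for v
      using mult[OF that] l(5) by (auto simp: mscale_mult contraction_mscale mscale_simps)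
    have "l' \<notin> mpoly.span {t}" if t: "t \<in> T" for t
    proof
      assume "l' \<in> mpoly.span {t}"
      hence "l \<in> mpoly.span {r t}" by (intro r[OF t l(1)] polar)
      thus False using l(6)[of "r t"] t by simp
    qed
    moreover have "l \<notin> mpoly.span {t}" if "t \<in> T" for t using l(6) that by simp
    ultimately have "l \<in> mpoly.span {l'}" using no_pair l(1-5) by blast
    hence "l' \<in> mpoly.span {l}" using l(3) by (rule in_span_singleton_commute)
    hence "contraction (l * l) f = 0" by (rule polar)
    moreover have "\<forall>t\<in>T \<union> S. l \<notin> mpoly.span {t}" using l(6) by blast
    ultimately show ?thesis using l(1,3) by blast
  qed
  \<comment> \<open>The points \<open>a\<close>, \<open>b\<close>, \<open>c\<close> are distinct and
    off \<open>T\<close>, so two of them that are polar to each other form an excluded pair.\<close>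
  obtain a where a: "a \<in> forms 1" "a \<noteq> 0" "contraction (a * a) f = 0" "\<And>t. t \<in> T \<Longrightarrow> a \<notin> mpoly.span {t}"
    using singular_point[of "{}"] by auto
  obtain b where b: "b \<in> forms 1" "b \<noteq> 0" "contraction (b * b) f = 0" "\<And>t. t \<in> T \<Longrightarrow> b \<notin> mpoly.span {t}"
    "b \<notin> mpoly.span {a}"
    using singular_point[of "{a}"] by auto
  obtain c where c: "c \<in> forms 1" "c \<noteq> 0" "contraction (c * c) f = 0" "\<And>t. t \<in> T \<Longrightarrow> c \<notin> mpoly.span {t}"
    "c \<notin> mpoly.span {a}" "c \<notin> mpoly.span {b}"
    using singular_point[of "{a, b}"] by auto
  obtain e where e: "e \<in> forms 1" "contraction (e * e) f = 0"
    "e \<notin> mpoly.span {a}" "e \<notin> mpoly.span {b}" "e \<notin> mpoly.span {c}"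
    using singular_point[of "{a, b, c}"] by auto
  show False
    using polar_pair_among_four_singular_points[OF card f a(1) b(1) c(1) e(1) a(2) b(5) c(5,6) e(3-5)
        a(3) b(3) c(3) e(2)] no_pair a b c
    by metis
qed

section \<open>Induction on the degree\<close>

text \<open>The condition on \<open>T\<close> is guarded by \<open>f \<noteq> 0\<close> because the
  zero form is allowed: the induction adds the chosen point to \<open>T\<close>, and no nonempty
  \<open>T\<close> could satisfy the unguarded condition for \<open>f = 0\<close>.\<close>

lemma exists_polar_product:
  fixes f :: "('x::finite, 'k::{alg_closed_field, field_char_0}) mpoly"
  assumes card: "CARD('x) = 3" and "3 \<le> d" "f \<in> forms d" "finite T" "T \<subseteq> forms 1"
    and "\<And>s t. f \<noteq> 0 \<Longrightarrow> s \<in> T \<Longrightarrow> t \<in> T \<Longrightarrow> contraction (s * t) f \<noteq> 0"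
  shows "\<exists>l. (\<forall>i\<in>{1..d-1}. l i \<in> forms 1 \<and> l i \<noteq> 0 \<and> (\<forall>s\<in>T. l i \<notin> mpoly.span {s})) \<and>
    (\<forall>i\<in>{1..d-1}. \<forall>j\<in>{1..d-1}. i \<noteq> j \<longrightarrow> l i \<notin> mpoly.span {l j}) \<and>
    contraction (\<Prod>i\<in>{1..d-1}. l i) f = 0"
  using assms(2-)
proof (induction d arbitrary: f T rule: dec_induct)
  case base
  have "\<exists>l\<in>forms 1. \<exists>l'\<in>forms 1. l \<noteq> 0 \<and> l' \<noteq> 0 \<and> l \<notin> mpoly.span {l'} \<and>
    (\<forall>t\<in>T. l \<notin> mpoly.span {t} \<and> l' \<notin> mpoly.span {t}) \<and> contraction (l * l') f = 0"
  proof (cases "f = 0")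
    case True
    \<comment> \<open>\<open>mpoly.span {0, s}\<close> is \<open>mpoly.span {s}\<close>, and
      avoiding \<open>s = 0\<close> makes the form nonzero.\<close>
    obtain a where a: "a \<in> forms 1" "\<forall>s\<in>insert 0 T. a \<notin> mpoly.span {0, s}"
      using exists_form_avoiding_spans[OF card, of "insert 0 T" 0] base.prems(2) by blast
    obtain b where b: "b \<in> forms 1" "\<forall>s\<in>insert a (insert 0 T). b \<notin> mpoly.span {0, s}"
      using exists_form_avoiding_spans[OF card, of "insert a (insert 0 T)" 0] base.prems(2) by blast
    show ?thesis
      by (rule bexI[OF _ b(1)], rule bexI[OF _ a(1)])
        (use a(2) b(2) True in \<open>auto simp: contraction_zero_right\<close>)
  next
    case False
    thus ?thesis using cubic_polar_pair[OF card base.prems(1-3)] base.prems(4) by blast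
  qed
  then obtain l l' where l: "l \<in> forms 1" "l' \<in> forms 1" "l \<noteq> 0" "l' \<noteq> 0" "l \<notin> mpoly.span {l'}"
    "contraction (l * l') f = 0" "\<forall>t\<in>T. l \<notin> mpoly.span {t} \<and> l' \<notin> mpoly.span {t}" by blast
  have "l' \<notin> mpoly.span {l}" using in_span_singleton_commute[OF _ l(4)] l(5) by blast
  moreover have "{1..3 - 1 :: nat} = {1, 2}" by auto
  ultimately show ?case
    by (intro exI[of _ "\<lambda>i. if i = 1 then l else l'"]) (use l in auto)
next
  case (step d)
  \<comment> \<open>Adding \<open>p\<close> to \<open>T\<close> makes the remaining factors differ
    from \<open>p\<close>.\<close>
  have "\<exists>p\<in>forms 1. p \<noteq> 0 \<and> (\<forall>s\<in>T. p \<notin> mpoly.span {s}) \<and>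
    (contraction p f \<noteq> 0 \<longrightarrow> (\<forall>s\<in>insert p T. \<forall>t\<in>insert p T. contraction (s * t) (contraction p f) \<noteq> 0))"
  proof (cases "f = 0")
    case True
    obtain a where a: "a \<in> forms 1" "\<forall>s\<in>insert 0 T. a \<notin> mpoly.span {0, s}"
      using exists_form_avoiding_spans[OF card, of "insert 0 T" 0] step.prems(2) by blast
    thus ?thesis using True by (intro bexI[of _ a]) (auto simp: contraction_zero_right)
  next
    case False
    define U where "U k h = {l :: ('x, 'k) mpoly. contraction (l ^ k) h \<noteq> 0}" for k h
    have generic_U: "generic (U k h)" if "h \<in> forms n" "h \<noteq> 0" "k \<le> n" for k h n
      unfolding U_def using that by (rule generic_contraction_power_neq_0)
    have f3: "f \<in> forms (Suc (d - 1) + 1)" "d - 1 \<ge> 2" using step.prems(1) step.hyps by simp_all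
    have f_s: "contraction s f \<in> forms d" if "s \<in> T" for s
      using step.prems(1,3) that by (intro contraction_in_forms) auto
    have f_st: "contraction (s * t) f \<in> forms (d - 1)" if "s \<in> T" "t \<in> T" for s t
      using that step.prems(3) f3(1) by (intro contraction2_in_forms) auto
    have nz: "contraction (s * t) f \<noteq> 0" if "s \<in> T" "t \<in> T" for s t
      using step.prems(4)[OF False that] .
    \<comment> \<open>The case \<open>t = s\<close> of \<open>nz\<close>.\<close>
    hence nz': "contraction s f \<noteq> 0" if "s \<in> T" for s
      using that by (metis contraction_mult contraction_zero_right)
    \<comment> \<open>The exponent counts the factors \<open>p\<close> in \<open>s * t * p\<close>:
      three if \<open>s\<close> and \<open>t\<close> are both \<open>p\<close>, two if one is, one
      if neither is. The last condition keeps \<open>p\<close> nonzero and off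
      \<open>T\<close>.\<close>
    have "generic (U 3 f)"
      using step.hyps False by (intro generic_U[OF step.prems(1)]) auto
    moreover have "generic (\<Inter>s\<in>T. U 2 (contraction s f))"
      using step.hyps step.prems(2) nz'
      by (intro generic_Inter) (auto intro!: generic_U[OF f_s])
    moreover have "generic (\<Inter>(s, t)\<in>T \<times> T. U 1 (contraction (s * t) f))"
      using f3(2) step.prems(2) nz
      by (intro generic_Inter) (auto intro!: generic_U[OF f_st])
    moreover have "generic (\<Inter>s\<in>insert 0 T. - mpoly.span {s})"
    proof (rule generic_Inter)
      fix V assume "V \<in> (\<lambda>s. - mpoly.span {s}) ` insert 0 T"
      then obtain s where "V = - mpoly.span {s}" by blast
      thus "generic V" using generic_Compl_span[OF card, of "{s}"] by simp
    qed (use step.prems(2) in simp)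
    ultimately have "generic (U 3 f \<inter> ((\<Inter>s\<in>T. U 2 (contraction s f)) \<inter>
      ((\<Inter>(s, t)\<in>T \<times> T. U 1 (contraction (s * t) f)) \<inter> (\<Inter>s\<in>insert 0 T. - mpoly.span {s}))))"
      by (intro generic_Int)
    then obtain p where p_V: "p \<in> forms 1" and p_U: "p \<in> U 3 f" "p \<in> (\<Inter>s\<in>T. U 2 (contraction s f))"
      "p \<in> (\<Inter>(s, t)\<in>T \<times> T. U 1 (contraction (s * t) f))" "p \<in> (\<Inter>s\<in>insert 0 T. - mpoly.span {s})"
      unfolding generic_def by (elim conjE bexE IntE)
    have p_T: "p \<notin> mpoly.span {s}" if "s \<in> insert 0 T" for s
      using INT_D[OF p_U(4) that] by simp
    have p_T2: "p \<in> U 1 (contraction (s * t) f)" if "s \<in> T" "t \<in> T" for s t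
      using INT_D[OF p_U(3), of "(s, t)"] that by simp
    have "contraction (s * t) (contraction p f) \<noteq> 0" if "s \<in> insert p T" "t \<in> insert p T" for s t
    proof -
      have eq: "s * t * p = p ^ 1 * (s * t)" "p * t * p = p ^ 2 * t" "s * p * p = p ^ 2 * s" "p * p * p = p ^ 3"
        by (simp_all add: power2_eq_square power3_eq_cube ac_simps)
      have U: "p \<in> U k (contraction h f) \<longleftrightarrow> contraction (p ^ k * h) f \<noteq> 0" for k h
        by (simp add: U_def contraction_mult)
      have "contraction (s * t * p) f \<noteq> 0"
      proof (cases "s = p"; cases "t = p")
        assume "s = p" "t = p"
        thus ?thesis using p_U(1) eq(4) by (simp add: U_def)
      next
        assume "s = p" "t \<noteq> p"
        thus ?thesis using that INT_D[OF p_U(2), of t] eq(2) by (simp add: U)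
      next
        assume "s \<noteq> p" "t = p"
        thus ?thesis using that INT_D[OF p_U(2), of s] eq(3) by (simp add: U)
      next
        assume "s \<noteq> p" "t \<noteq> p"
        thus ?thesis using that p_T2[of s t] unfolding eq(1) U by blast
      qed
      thus ?thesis by (simp add: contraction_mult)
    qed
    thus ?thesis using p_V p_T[of 0] p_T by (intro bexI[of _ p]) auto
  qed
  then obtain p where p: "p \<in> forms 1" "p \<noteq> 0" "\<And>s. s \<in> T \<Longrightarrow> p \<notin> mpoly.span {s}"
    "\<And>s t. contraction p f \<noteq> 0 \<Longrightarrow> s \<in> insert p T \<Longrightarrow> t \<in> insert p T \<Longrightarrow> contraction (s * t) (contraction p f) \<noteq> 0"
    by blast
  have "\<exists>l. (\<forall>i\<in>{1..d-1}. l i \<in> forms 1 \<and> l i \<noteq> 0 \<and> (\<forall>s\<in>insert p T. l i \<notin> mpoly.span {s})) \<and>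
    (\<forall>i\<in>{1..d-1}. \<forall>j\<in>{1..d-1}. i \<noteq> j \<longrightarrow> l i \<notin> mpoly.span {l j}) \<and>
    contraction (\<Prod>i\<in>{1..d-1}. l i) (contraction p f) = 0"
    by (rule step.IH[OF contraction_in_forms[OF p(1) step.prems(1)]])
      (use step.prems(2,3) p(1,4) in auto)
  then obtain l where l: "\<And>i. i \<in> {1..d-1} \<Longrightarrow> l i \<in> forms 1 \<and> l i \<noteq> 0 \<and> (\<forall>s\<in>insert p T. l i \<notin> mpoly.span {s})"
    "\<And>i j. i \<in> {1..d-1} \<Longrightarrow> j \<in> {1..d-1} \<Longrightarrow> i \<noteq> j \<Longrightarrow> l i \<notin> mpoly.span {l j}"
    "contraction (\<Prod>i\<in>{1..d-1}. l i) (contraction p f) = 0" by blast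
  have p_l: "p \<notin> mpoly.span {l i}" if "i \<in> {1..d-1}" for i
    using in_span_singleton_commute[of p "l i"] p(2) l(1)[OF that] by blast
  \<comment> \<open>The factors found by induction keep the indices \<open>1\<close> to
    \<open>d-1\<close>, and \<open>p\<close> takes the new index \<open>d\<close>.\<close>
  have d: "{1..Suc d - 1} = insert d {1..d-1}" "d \<notin> {1..d-1}" using step.hyps by auto
  have "(\<Prod>i\<in>{1..Suc d - 1}. (l(d := p)) i) = p * (\<Prod>i\<in>{1..d-1}. (l(d := p)) i)"
    unfolding d(1) using d(2) by (subst prod.insert) auto
  also have "(\<Prod>i\<in>{1..d-1}. (l(d := p)) i) = (\<Prod>i\<in>{1..d-1}. l i)"
    using d(2) by (intro prod.cong) auto
  finally have "contraction (\<Prod>i\<in>{1..Suc d - 1}. (l(d := p)) i) f = 0"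
    using l(3) by (simp only: mult.commute[of p] contraction_mult)
  moreover have "\<forall>i\<in>{1..Suc d - 1}. (l(d := p)) i \<in> forms 1 \<and> (l(d := p)) i \<noteq> 0 \<and>
      (\<forall>s\<in>T. (l(d := p)) i \<notin> mpoly.span {s})"
    unfolding d(1) using l(1) p(1-3) by (simp del: One_nat_def)
  moreover have "\<forall>i\<in>{1..Suc d - 1}. \<forall>j\<in>{1..Suc d - 1}. i \<noteq> j \<longrightarrow>
      (l(d := p)) i \<notin> mpoly.span {(l(d := p)) j}"
    unfolding d(1) using l(1,2) p_l by (simp del: One_nat_def)
  ultimately show ?case by blast
qed

section \<open>From linear forms to points of the projective plane\<close>

theorem proposition4p3:
  fixes f :: "('x::finite, 'k::{alg_closed_field, field_char_0}) mpoly"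
    and \<Sigma> :: "('x, 'k) mpoly set set"
    and d :: nat
  assumes "mpoly.dim (forms 1 :: ('x, 'k) mpoly set) = 3"
    and "d \<ge> 3"
    and "f \<in> forms d"
    and "finite \<Sigma>"
    and "\<Sigma> \<subseteq> proj_space (forms 1)"
    and "\<And>l' l''. mpoly.span {l'} \<in> \<Sigma> \<Longrightarrow> mpoly.span {l''} \<in> \<Sigma> \<Longrightarrow> contraction (l' * l'') f \<noteq> 0"
  shows "\<exists>l :: nat \<Rightarrow> ('x, 'k) mpoly.
    (\<forall>i\<in>{1..d-1}. mpoly.span {l i} \<in> proj_space (forms 1) - \<Sigma>) \<and>
    inj_on (\<lambda>i. mpoly.span {l i}) {1..d-1} \<and>
    contraction (\<Prod>i\<in>{1..d-1}. l i) f = 0"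
proof -
  have card: "CARD('x) = 3" using assms(1) by (simp only: dim_forms_1)
  \<comment> \<open>A spanning vector \<open>v P\<close> is chosen for every point \<open>P\<close>
    of \<Sigma>.\<close>
  have "\<forall>P\<in>\<Sigma>. \<exists>v. v \<in> forms 1 \<and> P = mpoly.span {v}"
    using assms(5) unfolding proj_space_def by blast
  then obtain v where v: "\<And>P. P \<in> \<Sigma> \<Longrightarrow> v P \<in> forms 1" "\<And>P. P \<in> \<Sigma> \<Longrightarrow> P = mpoly.span {v P}"
    by metis
  have v_\<Sigma>: "mpoly.span {v P} \<in> \<Sigma>" if "P \<in> \<Sigma>" for P
    using that by (simp flip: v(2))
  have "\<exists>l. (\<forall>i\<in>{1..d-1}. l i \<in> forms 1 \<and> l i \<noteq> 0 \<and> (\<forall>s\<in>v ` \<Sigma>. l i \<notin> mpoly.span {s})) \<and>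
    (\<forall>i\<in>{1..d-1}. \<forall>j\<in>{1..d-1}. i \<noteq> j \<longrightarrow> l i \<notin> mpoly.span {l j}) \<and>
    contraction (\<Prod>i\<in>{1..d-1}. l i) f = 0"
  proof (rule exists_polar_product[OF card assms(2,3)])
    show "finite (v ` \<Sigma>)" using assms(4) by (rule finite_imageI)
    show "v ` \<Sigma> \<subseteq> forms 1" using v(1) by (rule image_subsetI)
    show "contraction (s * t) f \<noteq> 0" if "s \<in> v ` \<Sigma>" "t \<in> v ` \<Sigma>" for s t
    proof -
      from that obtain P Q where "P \<in> \<Sigma>" "Q \<in> \<Sigma>" "s = v P" "t = v Q" by (elim imageE)
      thus ?thesis using v_\<Sigma> by (simp only: assms(6) not_False_eq_True)
    qed
  qed
  then obtain l where l: "\<forall>i\<in>{1..d-1}. l i \<in> forms 1 \<and> l i \<noteq> 0 \<and> (\<forall>s\<in>v ` \<Sigma>. l i \<notin> mpoly.span {s})"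
    "\<forall>i\<in>{1..d-1}. \<forall>j\<in>{1..d-1}. i \<noteq> j \<longrightarrow> l i \<notin> mpoly.span {l j}"
    "contraction (\<Prod>i\<in>{1..d-1}. l i) f = 0" by (elim exE conjE)
  have self: "l i \<in> mpoly.span {l i}" for i by (simp add: mpoly.span_base)
  have "mpoly.span {l i} \<in> proj_space (forms 1) - \<Sigma>" if i: "i \<in> {1..d-1}" for i
  proof
    show "mpoly.span {l i} \<in> proj_space (forms 1)"
      unfolding proj_space_def using bspec[OF l(1) i] by blast
    show "mpoly.span {l i} \<notin> \<Sigma>"
    proof
      assume "mpoly.span {l i} \<in> \<Sigma>"
      \<comment> \<open>\<open>P\<close> is the span of \<open>l i\<close> itself and is also
        spanned by \<open>v P\<close>, a span that \<open>l i\<close> avoids.\<close>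
      then obtain P where P: "P \<in> \<Sigma>" "l i \<in> P" using self by blast
      have "P \<subseteq> mpoly.span {v P}" using v(2)[OF P(1)] by (rule equalityD1)
      thus False using bspec[OF l(1) i] P by blast
    qed
  qed
  moreover have "inj_on (\<lambda>i. mpoly.span {l i}) {1..d-1}"
  proof (rule inj_onI, rule ccontr)
    fix i j
    assume "i \<in> {1..d-1}" "j \<in> {1..d-1}" and eq: "mpoly.span {l i} = mpoly.span {l j}" and "i \<noteq> j"
    with l(2) have "l i \<notin> mpoly.span {l j}" by blast
    thus False using self[of i] unfolding eq by (rule notE)
  qed
  ultimately show ?thesis using l(3) by blast
qed

end
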